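(* Let the Finsler space $(M,F)$, $\dim M=N\ge3$, be conformally automorphic to the Riemannian space $(M,S)$ with degree $H$ through the transformation $t=t(x,y)$. If $d_iF=0$ and $H=\mathrm{const}$, with the coefficients $$N^m{}_n=-y^m_i\left(\frac{\partial t^i}{\partial x^n}+a^i{}_{kn}t^k\right),$$ then the deformation tensor $\mathcal C^m_k=p\,t^m_k$ is parallel: $$\mathcal D_n\mathcal C^m_k=0,$$ where $$\mathcal D_n\mathcal C^m_k=d_n\mathcal C^m_k-D^h{}_{nk}\,\mathcal C^m_h+a^m{}_{nl}\,\mathcal C^l_k .$$
   Context: $M$ is a $C^\infty$ manifold with local coordinates $x^i$; $y^i$ are the induced coordinates of tangent vectors $y\in T_xM\setminus0$; repeated indices are summed over $1,\dots,N$; considerations are local. The Finsler metric function $F(x,y)$ is smooth, positive, positively homogeneous of degree 1 in $y$, with positive-definite $g_{ij}=\frac12\,\partial^2F^2/\partial y^i\partial y^j$. $S(x,y)=\sqrt{a_{ij}(x)y^iy^j}$ is a Riemannian metric function and $a^i{}_{kn}(x)$ are the Christoffel symbols of $a_{ij}$. Definition. $(M,F)$ is conformally automorphic to $(M,S)$, of degree $H=H(x)>0$, if there is a smooth family of invertible smooth transformations $y\mapsto t=t(x,y)$ of nonzero tangent vectors at $x$ into nonzero tangent vectors at the same $x$ such that: (i) $t^m(x,ky)=k^{H}t^m(x,y)$ for all $k>0$; (ii) $F(x,y)=1\iff S(x,t(x,y))=1$; (iii) $g_{mn}(x,y)=p^2\,a_{ij}(x)\,t^i_m t^j_n$, where $t^i_m=\partial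 t^i/\partial y^m$ and $p=p(x,y)>0$; here $p=\frac1HF^{1-H}$. Notation: $y=y(x,t)$ is the inverse transformation and $y^m_i=\partial y^m/\partial t^i$, evaluated at $t=t(x,y)$; $d_n=\frac{\partial}{\partial x^n}+N^k{}_n\frac{\partial}{\partial y^k}$; $D^h{}_{nk}=-\partial N^h{}_n/\partial y^k$. *)

theory Defs
  imports "HOL-Analysis.Analysis"
begin

text \<open>
  All considerations are local: the manifold is represented by the domain
  \<open>U\<close> of a coordinate chart, an open subset of \<open>real ^ 'n\<close>, and all tensors by their components.
  A function \<open>f x y\<close> on the slit tangent bundle has the base point
  \<open>x \<in> U\<close> as first and the nonzero tangent vector \<open>y\<close> as second argument; its values outside
  \<open>U \<times> (- {0})\<close> are irrelevant.
\<close>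

section \<open>Smooth functions and partial derivatives\<close>

primrec Ck_on :: "nat \<Rightarrow> 'a::euclidean_space set \<Rightarrow> ('a \<Rightarrow> 'b::real_normed_vector) \<Rightarrow> bool" where
  "Ck_on 0 S f \<longleftrightarrow> continuous_on S f"
| "Ck_on (Suc k) S f \<longleftrightarrow> (\<forall>x\<in>S. f differentiable (at x)) \<and>
     (\<forall>v. Ck_on k S (\<lambda>x. frechet_derivative f (at x) v))"

text \<open>Intended for open \<open>S\<close> only, since the derivatives are two-sided.\<close>

definition smooth_on :: "'a::euclidean_space set \<Rightarrow> ('a \<Rightarrow> 'b::real_normed_vector) \<Rightarrow> bool" where
  "smooth_on S f \<longleftrightarrow> (\<forall>k. Ck_on k S f)"

definition pd :: "'n::finite \<Rightarrow> (real ^ 'n \<Rightarrow> real) \<Rightarrow> real ^ 'n \<Rightarrow> real" where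
  "pd i f x = deriv (\<lambda>s. f (x + s *\<^sub>R axis i 1)) 0"

section \<open>Riemannian and Finsler metrics\<close>

definition riemannian_metric :: "(real ^ 'n::finite) set \<Rightarrow> (real ^ 'n \<Rightarrow> real ^ 'n ^ 'n) \<Rightarrow> bool" where
  "riemannian_metric U a \<longleftrightarrow>
     smooth_on U a \<and>
     (\<forall>x\<in>U. \<forall>i j. a x $ i $ j = a x $ j $ i) \<and>
     (\<forall>x\<in>U. \<forall>v. v \<noteq> 0 \<longrightarrow> (\<Sum>i\<in>UNIV. \<Sum>j\<in>UNIV. a x $ i $ j * v $ i * v $ j) > 0)"

definition riemannian_norm :: "(real ^ 'n::finite \<Rightarrow> real ^ 'n ^ 'n) \<Rightarrow> real ^ 'n \<Rightarrow> real ^ 'n \<Rightarrow> real" where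
  "riemannian_norm a x y = sqrt (\<Sum>i\<in>UNIV. \<Sum>j\<in>UNIV. a x $ i $ j * y $ i * y $ j)"

text \<open>\<open>christoffel a x i k n\<close> has the upper index \<open>i\<close> and the lower indices \<open>k\<close>, \<open>n\<close>.\<close>

definition christoffel :: "(real ^ 'n::finite \<Rightarrow> real ^ 'n ^ 'n) \<Rightarrow> real ^ 'n \<Rightarrow> 'n \<Rightarrow> 'n \<Rightarrow> 'n \<Rightarrow> real" where
  "christoffel a x i k n =
     (1 / 2) * (\<Sum>s\<in>UNIV. matrix_inv (a x) $ i $ s *
       (pd k (\<lambda>z. a z $ s $ n) x + pd n (\<lambda>z. a z $ s $ k) x - pd s (\<lambda>z. a z $ k $ n) x))"

definition finsler_tensor :: "(real ^ 'n::finite \<Rightarrow> real ^ 'n \<Rightarrow> real) \<Rightarrow> real ^ 'n \<Rightarrow> real ^ 'n \<Rightarrow> 'n \<Rightarrow> 'n \<Rightarrow> real" where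
  "finsler_tensor F x y i j = (1 / 2) * pd i (pd j (\<lambda>w. (F x w)\<^sup>2)) y"

definition finsler_metric :: "(real ^ 'n::finite) set \<Rightarrow> (real ^ 'n \<Rightarrow> real ^ 'n \<Rightarrow> real) \<Rightarrow> bool" where
  "finsler_metric U F \<longleftrightarrow>
     smooth_on (U \<times> (- {0})) (\<lambda>(x, y). F x y) \<and>
     (\<forall>x\<in>U. \<forall>y. y \<noteq> 0 \<longrightarrow> F x y > 0) \<and>
     (\<forall>x\<in>U. \<forall>y. y \<noteq> 0 \<longrightarrow> (\<forall>k>0. F x (k *\<^sub>R y) = k * F x y)) \<and>
     (\<forall>x\<in>U. \<forall>y. y \<noteq> 0 \<longrightarrow> (\<forall>v. v \<noteq> 0 \<longrightarrow>
        (\<Sum>i\<in>UNIV. \<Sum>j\<in>UNIV. finsler_tensor F x y i j * v $ i * v $ j) > 0))"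

section \<open>Conformal automorphism\<close>

text \<open>\<open>dt t x y i m\<close> is \<open>\<partial>t\<^sup>i / \<partial>y\<^sup>m\<close>.\<close>

definition dt :: "(real ^ 'n::finite \<Rightarrow> real ^ 'n \<Rightarrow> real ^ 'n) \<Rightarrow> real ^ 'n \<Rightarrow> real ^ 'n \<Rightarrow> 'n \<Rightarrow> 'n \<Rightarrow> real" where
  "dt t x y i m = pd m (\<lambda>z. t x z $ i) y"

text \<open>\<open>dy t x y m i\<close> is \<open>\<partial>y\<^sup>m / \<partial>t\<^sup>i\<close>, evaluated at \<open>t x y\<close>, where \<open>y\<close> as a function of \<open>t\<close> is the
  inverse of the bijection \<open>t x\<close> of the nonzero tangent vectors.\<close>

definition dy :: "(real ^ 'n::finite \<Rightarrow> real ^ 'n \<Rightarrow> real ^ 'n) \<Rightarrow> real ^ 'n \<Rightarrow> real ^ 'n \<Rightarrow> 'n \<Rightarrow> 'n \<Rightarrow> real" where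
  "dy t x y m i = pd i (\<lambda>\<tau>. the_inv_into (- {0}) (t x) \<tau> $ m) (t x y)"

text \<open>Smoothness of the inverse transformations is not required separately: by the metric condition
  the Jacobian of \<open>t x\<close> never degenerates.\<close>

definition conformally_automorphic_via ::
  "(real ^ 'n::finite) set \<Rightarrow> (real ^ 'n \<Rightarrow> real ^ 'n \<Rightarrow> real) \<Rightarrow> (real ^ 'n \<Rightarrow> real ^ 'n ^ 'n) \<Rightarrow>
   (real ^ 'n \<Rightarrow> real) \<Rightarrow> (real ^ 'n \<Rightarrow> real ^ 'n \<Rightarrow> real ^ 'n) \<Rightarrow> (real ^ 'n \<Rightarrow> real ^ 'n \<Rightarrow> real) \<Rightarrow> bool" where
  "conformally_automorphic_via U F a H t p \<longleftrightarrow>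
     (\<forall>x\<in>U. H x > 0) \<and>
     smooth_on (U \<times> (- {0})) (\<lambda>(x, y). t x y) \<and>
     (\<forall>x\<in>U. bij_betw (t x) (- {0}) (- {0})) \<and>
     (\<forall>x\<in>U. \<forall>y. y \<noteq> 0 \<longrightarrow> (\<forall>k>0. t x (k *\<^sub>R y) = (k powr H x) *\<^sub>R t x y)) \<and>
     (\<forall>x\<in>U. \<forall>y. y \<noteq> 0 \<longrightarrow> (F x y = 1 \<longleftrightarrow> riemannian_norm a x (t x y) = 1)) \<and>
     (\<forall>x\<in>U. \<forall>y. y \<noteq> 0 \<longrightarrow>
        p x y > 0 \<and>
        p x y = (1 / H x) * F x y powr (1 - H x) \<and>
        (\<forall>m n. finsler_tensor F x y m n =
           (p x y)\<^sup>2 * (\<Sum>i\<in>UNIV. \<Sum>j\<in>UNIV. a x $ i $ j * dt t x y i m * dt t x y j n)))"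

section \<open>The connection and the covariant derivative\<close>

text \<open>\<open>N_coeff a t x y m n\<close> is \<open>N\<^sup>m\<^sub>n\<close>.\<close>

definition N_coeff :: "(real ^ 'n::finite \<Rightarrow> real ^ 'n ^ 'n) \<Rightarrow> (real ^ 'n \<Rightarrow> real ^ 'n \<Rightarrow> real ^ 'n) \<Rightarrow>
    real ^ 'n \<Rightarrow> real ^ 'n \<Rightarrow> 'n \<Rightarrow> 'n \<Rightarrow> real" where
  "N_coeff a t x y m n =
     - (\<Sum>i\<in>UNIV. dy t x y m i *
          (pd n (\<lambda>z. t z y $ i) x + (\<Sum>k\<in>UNIV. christoffel a x i k n * t x y $ k)))"

text \<open>In the following, \<open>N\<close> stands for arbitrary coefficients \<open>N x y m n = N\<^sup>m\<^sub>n (x, y)\<close>.\<close>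

definition d_op :: "(real ^ 'n::finite \<Rightarrow> real ^ 'n \<Rightarrow> 'n \<Rightarrow> 'n \<Rightarrow> real) \<Rightarrow> 'n \<Rightarrow>
    (real ^ 'n \<Rightarrow> real ^ 'n \<Rightarrow> real) \<Rightarrow> real ^ 'n \<Rightarrow> real ^ 'n \<Rightarrow> real" where
  "d_op N n f x y = pd n (\<lambda>z. f z y) x + (\<Sum>k\<in>UNIV. N x y k n * pd k (f x) y)"

text \<open>\<open>D_coeff N x y h n k\<close> is \<open>D\<^sup>h\<^sub>n\<^sub>k\<close>.\<close>

definition D_coeff :: "(real ^ 'n::finite \<Rightarrow> real ^ 'n \<Rightarrow> 'n \<Rightarrow> 'n \<Rightarrow> real) \<Rightarrow>
    real ^ 'n \<Rightarrow> real ^ 'n \<Rightarrow> 'n \<Rightarrow> 'n \<Rightarrow> 'n \<Rightarrow> real" where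
  "D_coeff N x y h n k = - pd k (\<lambda>z. N x z h n) y"

definition deformation_tensor :: "(real ^ 'n::finite \<Rightarrow> real ^ 'n \<Rightarrow> real) \<Rightarrow>
    (real ^ 'n \<Rightarrow> real ^ 'n \<Rightarrow> real ^ 'n) \<Rightarrow> real ^ 'n \<Rightarrow> real ^ 'n \<Rightarrow> 'n \<Rightarrow> 'n \<Rightarrow> real" where
  "deformation_tensor p t x y m k = p x y * dt t x y m k"

text \<open>\<open>cov_deriv N a C n m k x y\<close> is \<open>\<D>\<^sub>n C\<^sup>m\<^sub>k\<close>. The upper index of \<open>C\<close> refers to the Riemannian
  side of the deformation and is acted on by the Christoffel symbols of \<open>a\<close>.\<close>

definition cov_deriv :: "(real ^ 'n::finite \<Rightarrow> real ^ 'n \<Rightarrow> 'n \<Rightarrow> 'n \<Rightarrow> real) \<Rightarrow>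
    (real ^ 'n \<Rightarrow> real ^ 'n ^ 'n) \<Rightarrow> (real ^ 'n \<Rightarrow> real ^ 'n \<Rightarrow> 'n \<Rightarrow> 'n \<Rightarrow> real) \<Rightarrow>
    'n \<Rightarrow> 'n \<Rightarrow> 'n \<Rightarrow> real ^ 'n \<Rightarrow> real ^ 'n \<Rightarrow> real" where
  "cov_deriv N a C n m k x y =
     d_op N n (\<lambda>x y. C x y m k) x y
     - (\<Sum>h\<in>UNIV. D_coeff N x y h n k * C x y m h)
     + (\<Sum>l\<in>UNIV. christoffel a x m n l * C x y l k)"

end

theory Submission
  imports Defs
begin

text \<open>
  The coefficients \<open>N\<close> are chosen so that \<open>d\<^sub>n t\<^sup>m = - a\<^sup>m\<^sub>k\<^sub>n t\<^sup>k\<close>. Differentiating this identity with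
  respect to \<open>y\<^sup>k\<close> and exchanging the order of differentiation shows that the Jacobian \<open>t\<^sup>m\<^sub>k\<close> is
  parallel. As \<open>p\<close> is a function of \<open>F\<close> alone when \<open>H\<close> is constant, \<open>d\<^sub>n F = 0\<close> gives \<open>d\<^sub>n p = 0\<close>,
  so \<open>p t\<^sup>m\<^sub>k\<close> is parallel too. The coefficients \<open>N\<close> solve a linear system whose matrix is the Jacobian;
  their differentiability in \<open>y\<close> follows from Cramer's rule.
\<close>

lemma isCont_tendsto_nhds: "isCont f a \<Longrightarrow> (f \<longlongrightarrow> f a) (nhds a)"
  using tendsto_at_iff_tendsto_nhds[of f a] by (simp only: isCont_def)

section \<open>Symmetry of second derivatives\<close>

text \<open>The second difference is \<open>G h - G 0\<close>, where \<open>G s\<close> is the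
  increment of \<open>f\<close> in direction \<open>v\<close> from the point
  \<open>z + s *\<^sub>R u\<close>. The mean value theorem, applied first in \<open>s\<close> and
  then in \<open>r\<close>, produces the intermediate point.\<close>

lemma second_difference_mean_value:
  fixes f :: "'a::real_normed_vector \<Rightarrow> real"
  assumes h: "h > 0"
    and box: "\<And>s r. 0 \<le> s \<Longrightarrow> s \<le> h \<Longrightarrow> 0 \<le> r \<Longrightarrow> r \<le> h \<Longrightarrow> z + s *\<^sub>R u + r *\<^sub>R v \<in> S"
    and f': "\<And>w. w \<in> S \<Longrightarrow> (f has_derivative f' w) (at w)"
    and fu': "\<And>w. w \<in> S \<Longrightarrow> ((\<lambda>w. f' w u) has_derivative fu' w) (at w)"
  shows "\<exists>s r. 0 \<le> s \<and> s \<le> h \<and> 0 \<le> r \<and> r \<le> h \<and>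
    f (z + h *\<^sub>R u + h *\<^sub>R v) - f (z + h *\<^sub>R u) - f (z + h *\<^sub>R v) + f z
      = h * h * fu' (z + s *\<^sub>R u + r *\<^sub>R v) v"
proof -
  have Du: "((\<lambda>s. f (z + s *\<^sub>R u + r *\<^sub>R v)) has_real_derivative f' (z + s *\<^sub>R u + r *\<^sub>R v) u) (at s)"
    if "0 \<le> s" "s \<le> h" "0 \<le> r" "r \<le> h" for s r
  proof -
    let ?w = "z + s *\<^sub>R u + r *\<^sub>R v"
    have lin: "linear (f' ?w)"
      using f'[OF box[OF that]] by (rule has_derivative_linear)
    have "((\<lambda>s. f (z + s *\<^sub>R u + r *\<^sub>R v)) has_derivative (\<lambda>d. f' ?w (d *\<^sub>R u))) (at s)"
      by (rule has_derivative_compose[where f = "\<lambda>s. z + s *\<^sub>R u + r *\<^sub>R v" and g = f and f' = "\<lambda>d. d *\<^sub>R u", OF _ f'[OF box[OF that]]]) (auto intro!: derivative_eq_intros)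
    then show ?thesis
      by (simp add: has_field_derivative_def linear_cmul[OF lin] mult_commute_abs)
  qed
  have Dv: "((\<lambda>r. f' (z + s *\<^sub>R u + r *\<^sub>R v) u) has_real_derivative fu' (z + s *\<^sub>R u + r *\<^sub>R v) v) (at r)"
    if "0 \<le> s" "s \<le> h" "0 \<le> r" "r \<le> h" for s r
  proof -
    let ?w = "z + s *\<^sub>R u + r *\<^sub>R v"
    have lin: "linear (fu' ?w)"
      using fu'[OF box[OF that]] by (rule has_derivative_linear)
    have "((\<lambda>r. f' (z + s *\<^sub>R u + r *\<^sub>R v) u) has_derivative (\<lambda>d. fu' ?w (d *\<^sub>R v))) (at r)"
      by (rule has_derivative_compose[where f = "\<lambda>r. z + s *\<^sub>R u + r *\<^sub>R v" and g = "\<lambda>w. f' w u" and f' = "\<lambda>d. d *\<^sub>R v", OF _ fu'[OF box[OF that]]]) (auto intro!: derivative_eq_intros)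
    then show ?thesis
      by (simp add: has_field_derivative_def linear_cmul[OF lin] mult_commute_abs)
  qed
  \<comment> \<open>The summand \<open>0 *\<^sub>R v\<close> is kept so that both terms of
    \<open>G\<close> match \<open>Du\<close>, with \<open>r = h\<close> and
    \<open>r = 0\<close>.\<close>
  define G where "G s = f (z + s *\<^sub>R u + h *\<^sub>R v) - f (z + s *\<^sub>R u + 0 *\<^sub>R v)" for s
  have "\<exists>s>0. s < h \<and> G h - G 0 = (h - 0) * (f' (z + s *\<^sub>R u + h *\<^sub>R v) u - f' (z + s *\<^sub>R u + 0 *\<^sub>R v) u)"
    unfolding G_def using h by (intro MVT2 DERIV_diff Du) auto
  then obtain s where s: "0 < s" "s < h"
    "G h - G 0 = h * (f' (z + s *\<^sub>R u + h *\<^sub>R v) u - f' (z + s *\<^sub>R u + 0 *\<^sub>R v) u)"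
    by auto
  have "\<exists>r>0. r < h \<and> f' (z + s *\<^sub>R u + h *\<^sub>R v) u - f' (z + s *\<^sub>R u + 0 *\<^sub>R v) u
      = (h - 0) * fu' (z + s *\<^sub>R u + r *\<^sub>R v) v"
    using h s by (intro MVT2 Dv) auto
  then obtain r where "0 < r" "r < h" "f' (z + s *\<^sub>R u + h *\<^sub>R v) u - f' (z + s *\<^sub>R u + 0 *\<^sub>R v) u
      = h * fu' (z + s *\<^sub>R u + r *\<^sub>R v) v"
    by auto
  with s show ?thesis
    by (intro exI[of _ s] exI[of _ r]) (auto simp: G_def)
qed

text \<open>The second difference does not change when \<open>u\<close> and \<open>v\<close> are
  exchanged. Evaluating it in both orders makes the two mixed derivatives equal at two points near
  \<open>z\<close>; continuity then carries the equality to \<open>z\<close>.\<close>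

lemma symmetric_second_derivative:
  fixes f :: "'a::real_normed_vector \<Rightarrow> real"
  assumes S: "open S" "z \<in> S"
    and f': "\<And>w. w \<in> S \<Longrightarrow> (f has_derivative f' w) (at w)"
    and fu': "\<And>w. w \<in> S \<Longrightarrow> ((\<lambda>w. f' w u) has_derivative fu' w) (at w)"
    and fv': "\<And>w. w \<in> S \<Longrightarrow> ((\<lambda>w. f' w v) has_derivative fv' w) (at w)"
    and cont: "continuous_on S (\<lambda>w. fu' w v)" "continuous_on S (\<lambda>w. fv' w u)"
  shows "fu' z v = fv' z u"
proof (rule ccontr)
  assume neq: "fu' z v \<noteq> fv' z u"
  \<comment> \<open>Half the gap: a number within \<open>e\<close> of \<open>fu' z v\<close> and one
    within \<open>e\<close> of \<open>fv' z u\<close> cannot coincide.\<close>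
  define e where "e = \<bar>fu' z v - fv' z u\<bar> / 2"
  have e: "e > 0" using neq by (simp add: e_def)
  have "isCont (\<lambda>w. fu' w v) z" "isCont (\<lambda>w. fv' w u) z"
    using cont S by (auto simp: continuous_on_eq_continuous_at)
  then have "\<forall>\<^sub>F w in nhds z. dist (fu' w v) (fu' z v) < e \<and> dist (fv' w u) (fv' z u) < e \<and> w \<in> S"
    using e S by (intro eventually_conj tendstoD[OF isCont_tendsto_nhds] eventually_nhds_in_open) auto
  then obtain d where d: "d > 0" and
    near: "\<And>w. dist w z < d \<Longrightarrow> dist (fu' w v) (fu' z v) < e \<and> dist (fv' w u) (fv' z u) < e \<and> w \<in> S"
    by (auto simp: eventually_nhds_metric)
  \<comment> \<open>With this side length every point of the parallelogram stays within
    \<open>d / 2\<close> of \<open>z\<close>; the summand 1 keeps the denominator positive when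
    \<open>u = v = 0\<close>.\<close>
  define h where "h = d / (2 * (norm u + norm v + 1))"
  have h: "h > 0" using d by (simp add: h_def add_nonneg_pos)
  \<comment> \<open>The disjunction covers both orders of \<open>u\<close> and \<open>v\<close>, as
    the mean value lemma is applied once in each.\<close>
  have ball: "dist (z + s *\<^sub>R p + r *\<^sub>R q) z < d"
    if "0 \<le> s" "s \<le> h" "0 \<le> r" "r \<le> h" "p = u \<and> q = v \<or> p = v \<and> q = u" for s r p q
  proof -
    have "dist (z + s *\<^sub>R p + r *\<^sub>R q) z \<le> s * norm p + r * norm q"
      using norm_triangle_ineq[of "s *\<^sub>R p" "r *\<^sub>R q"] that by (simp add: dist_norm add.assoc)
    also have "\<dots> \<le> h * norm p + h * norm q"
      using that by (intro add_mono mult_right_mono) auto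
    also have "\<dots> \<le> h * (norm u + norm v + 1)"
      using that h by (auto simp: algebra_simps)
    also have "\<dots> = d / 2"
    proof -
      have "norm u + norm v + 1 > 0" by (simp add: add_nonneg_pos)
      then show ?thesis unfolding h_def by (simp add: field_simps)
    qed
    finally show ?thesis using d by simp
  qed
  have box: "z + s *\<^sub>R p + r *\<^sub>R q \<in> S"
    if "0 \<le> s" "s \<le> h" "0 \<le> r" "r \<le> h" "p = u \<and> q = v \<or> p = v \<and> q = u" for s r p q
    using near[OF ball[OF that]] by simp
  obtain s r where 1: "0 \<le> s" "s \<le> h" "0 \<le> r" "r \<le> h"
    "f (z + h *\<^sub>R u + h *\<^sub>R v) - f (z + h *\<^sub>R u) - f (z + h *\<^sub>R v) + f z
      = h * h * fu' (z + s *\<^sub>R u + r *\<^sub>R v) v"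
    using second_difference_mean_value[where f=f and f'=f' and z=z and S=S and u=u and v=v, OF h _ f' fu'] box by auto
  obtain s' r' where 2: "0 \<le> s'" "s' \<le> h" "0 \<le> r'" "r' \<le> h"
    "f (z + h *\<^sub>R v + h *\<^sub>R u) - f (z + h *\<^sub>R v) - f (z + h *\<^sub>R u) + f z
      = h * h * fv' (z + s' *\<^sub>R v + r' *\<^sub>R u) u"
    using second_difference_mean_value[where f=f and f'=f' and z=z and S=S and u=v and v=u, OF h _ f' fv'] box by auto
  have "z + h *\<^sub>R v + h *\<^sub>R u = z + h *\<^sub>R u + h *\<^sub>R v" by (simp add: algebra_simps)
  with 1(5) 2(5) have "h * h * fu' (z + s *\<^sub>R u + r *\<^sub>R v) v = h * h * fv' (z + s' *\<^sub>R v + r' *\<^sub>R u) u"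
    by (simp only:)
  then have "fu' (z + s *\<^sub>R u + r *\<^sub>R v) v = fv' (z + s' *\<^sub>R v + r' *\<^sub>R u) u"
    using h by simp
  moreover have "dist (fu' (z + s *\<^sub>R u + r *\<^sub>R v) v) (fu' z v) < e"
    "dist (fv' (z + s' *\<^sub>R v + r' *\<^sub>R u) u) (fv' z u) < e"
    using near[OF ball[OF 1(1-4)], of u v] near[OF ball[OF 2(1-4)], of v u] by auto
  ultimately show False by (auto simp: e_def dist_real_def abs_if field_simps split: if_splits)
qed

section \<open>Smooth functions\<close>

text \<open>\<open>frechet_derivative\<close> is a Hilbert choice among derivatives, so it suffices
  that \<open>f\<close> and \<open>g\<close> have the same derivatives at \<open>x\<close>. This
  covers points of non-differentiability as well.\<close>

lemma frechet_derivative_cong_open: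
  assumes "open S" "x \<in> S" "\<And>x. x \<in> S \<Longrightarrow> f x = g x"
  shows "frechet_derivative f (at x) = frechet_derivative g (at x)"
proof -
  have "(f has_derivative D) (at x) \<longleftrightarrow> (g has_derivative D) (at x)" for D
    using assms has_derivative_transform_within_open[of f D x UNIV S g]
      has_derivative_transform_within_open[of g D x UNIV S f] by auto
  then show ?thesis unfolding frechet_derivative_def by simp
qed

lemma Ck_on_cong:
  assumes "open S" "\<And>x. x \<in> S \<Longrightarrow> f x = g x"
  shows "Ck_on k S f \<longleftrightarrow> Ck_on k S g"
  using assms(2)
proof (induction k arbitrary: f g)
  case 0
  then show ?case by (simp cong: continuous_on_cong)
next
  case (Suc k)
  have "f differentiable (at x) \<longleftrightarrow> g differentiable (at x)" if "x \<in> S" for x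
    using Suc.prems assms(1) that has_derivative_transform_within_open[of f _ x UNIV S g]
      has_derivative_transform_within_open[of g _ x UNIV S f]
    unfolding differentiable_def by metis
  moreover have "Ck_on k S (\<lambda>x. frechet_derivative f (at x) v) \<longleftrightarrow>
      Ck_on k S (\<lambda>x. frechet_derivative g (at x) v)" for v
    using Suc.prems assms(1) by (intro Suc.IH) (metis frechet_derivative_cong_open)
  ultimately show ?case by simp
qed

text \<open>Taking a component is bounded linear and so commutes with the derivative. The induction
  is over all \<open>f\<close>, since its step passes from \<open>f\<close> to its directional
  derivatives.\<close>

lemma Ck_on_vec_nth:
  fixes f :: "'a::euclidean_space \<Rightarrow> real ^ 'n::finite"
  assumes "open S" "Ck_on k S f"
  shows "Ck_on k S (\<lambda>x. f x $ i)"
  using assms(2)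
proof (induction k arbitrary: f)
  case 0
  then show ?case by (auto intro!: continuous_intros)
next
  case (Suc k)
  have D: "((\<lambda>x. f x $ i) has_derivative (\<lambda>v. frechet_derivative f (at x) v $ i)) (at x)" if "x \<in> S" for x
    using Suc.prems that
    by (auto intro!: bounded_linear.has_derivative[OF bounded_linear_vec_nth] simp flip: frechet_derivative_works)
  have "Ck_on k S (\<lambda>x. frechet_derivative (\<lambda>x. f x $ i) (at x) v)" for v
    using Suc D frechet_derivative_at[OF D]
    by (subst Ck_on_cong[OF assms(1), where g = "\<lambda>x. frechet_derivative f (at x) v $ i"]) (auto simp: fun_eq_iff)
  then show ?case using D by (auto simp: differentiable_def)
qed

lemma smooth_on_vec_nth:
  fixes f :: "'a::euclidean_space \<Rightarrow> real ^ 'n::finite"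
  assumes "open S" "smooth_on S f"
  shows "smooth_on S (\<lambda>x. f x $ i)"
  using assms Ck_on_vec_nth unfolding smooth_on_def by blast

lemma smooth_on_has_derivative:
  assumes "smooth_on S f" "x \<in> S"
  shows "(f has_derivative frechet_derivative f (at x)) (at x)"
  using assms Ck_on.simps(2)[of 0 S f] by (auto simp: smooth_on_def simp flip: frechet_derivative_works)

lemma smooth_on_frechet_derivative:
  assumes "smooth_on S f"
  shows "smooth_on S (\<lambda>x. frechet_derivative f (at x) v)"
  unfolding smooth_on_def
proof
  fix k
  show "Ck_on k S (\<lambda>x. frechet_derivative f (at x) v)"
    using assms Ck_on.simps(2)[of k S f] by (auto simp: smooth_on_def)
qed

lemma smooth_on_continuous_on: "smooth_on S f \<Longrightarrow> continuous_on S f"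
  unfolding smooth_on_def using Ck_on.simps(1) by blast

lemma smooth_on_symmetric:
  fixes f :: "'a::euclidean_space \<Rightarrow> real"
  assumes "open S" "smooth_on S f" "x \<in> S"
  shows "frechet_derivative (\<lambda>x. frechet_derivative f (at x) u) (at x) v
       = frechet_derivative (\<lambda>x. frechet_derivative f (at x) v) (at x) u"
  using assms
  by (intro symmetric_second_derivative[where f = f and f' = "\<lambda>x. frechet_derivative f (at x)" and S = S
          and fu' = "\<lambda>x. frechet_derivative (\<lambda>x. frechet_derivative f (at x) u) (at x)"])
     (auto intro!: smooth_on_has_derivative smooth_on_continuous_on smooth_on_frechet_derivative)

section \<open>Partial derivatives\<close>

text \<open>\<open>pd\<close> is defined by a one-variable \<open>deriv\<close> along a coordinate
  line; the chain rule along that line links it to the total derivative. The calculus rules for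
  \<open>pd\<close> below rest on this link.\<close>

lemma pd_eq:
  assumes "(f has_derivative f') (at x)"
  shows "pd i f x = f' (axis i 1)"
proof -
  have "((\<lambda>s. f (x + s *\<^sub>R axis i 1)) has_derivative (\<lambda>d. f' (d *\<^sub>R axis i 1))) (at 0)"
    by (rule has_derivative_compose[where g = f]) (use assms in \<open>auto intro!: derivative_eq_intros\<close>)
  then have "((\<lambda>s. f (x + s *\<^sub>R axis i 1)) has_real_derivative f' (axis i 1)) (at 0)"
    by (simp add: has_field_derivative_def linear_cmul[OF has_derivative_linear[OF assms]] mult_commute_abs)
  then show ?thesis unfolding pd_def by (rule DERIV_imp_deriv)
qed

text \<open>The coordinate line through \<open>x\<close> stays in \<open>S\<close> for small
  \<open>s\<close>, and \<open>deriv\<close> depends only on values near 0. No differentiability is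
  involved.\<close>

lemma pd_cong_open:
  assumes "open S" "x \<in> S" "\<And>z. z \<in> S \<Longrightarrow> f z = g z"
  shows "pd i f x = pd i g x"
proof -
  have "isCont (\<lambda>s. x + s *\<^sub>R axis i (1::real)) 0" by (intro continuous_intros)
  from isCont_tendsto_nhds[OF this]
  have "((\<lambda>s. x + s *\<^sub>R axis i 1) \<longlongrightarrow> x) (nhds (0::real))"
    by simp
  then have "\<forall>\<^sub>F s in nhds (0::real). x + s *\<^sub>R axis i 1 \<in> S"
    using assms(1,2) by (rule topological_tendstoD)
  then have "\<forall>\<^sub>F s in nhds 0. f (x + s *\<^sub>R axis i 1) = g (x + s *\<^sub>R axis i 1)"
    by (rule eventually_mono) (use assms(3) in auto)
  then show ?thesis unfolding pd_def by (intro deriv_cong_ev) auto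
qed

lemma pd_add:
  assumes "f differentiable (at x)" "g differentiable (at x)"
  shows "pd i (\<lambda>z. f z + g z) x = pd i f x + pd i g x"
proof -
  obtain f' g' where D: "(f has_derivative f') (at x)" "(g has_derivative g') (at x)"
    using assms by (auto simp: differentiable_def)
  show ?thesis using pd_eq[OF D(1)] pd_eq[OF D(2)] pd_eq[OF has_derivative_add[OF D]] by simp
qed

lemma pd_mult:
  assumes "f differentiable (at x)" "g differentiable (at x)"
  shows "pd i (\<lambda>z. f z * g z) x = pd i f x * g x + f x * pd i g x"
proof -
  obtain f' g' where D: "(f has_derivative f') (at x)" "(g has_derivative g') (at x)"
    using assms by (auto simp: differentiable_def)
  show ?thesis using pd_eq[OF D(1)] pd_eq[OF D(2)] pd_eq[OF has_derivative_mult[OF D]] by simp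
qed

lemma pd_sum:
  assumes "\<And>a. a \<in> A \<Longrightarrow> f a differentiable (at x)"
  shows "pd i (\<lambda>z. \<Sum>a\<in>A. f a z) x = (\<Sum>a\<in>A. pd i (f a) x)"
proof -
  have D: "\<And>a. a \<in> A \<Longrightarrow> (f a has_derivative frechet_derivative (f a) (at x)) (at x)"
    using assms by (simp flip: frechet_derivative_works)
  show ?thesis using pd_eq[OF has_derivative_sum[OF D]] pd_eq[OF D] by simp
qed

lemma smooth_on_cong:
  assumes "open S" "\<And>x. x \<in> S \<Longrightarrow> f x = g x"
  shows "smooth_on S f \<longleftrightarrow> smooth_on S g"
  using Ck_on_cong[OF assms] by (simp add: smooth_on_def)

text \<open>Smoothness is given jointly in \<open>(x, y)\<close>, whereas \<open>pd\<close> moves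
  one argument at a time. The chain rule with the embeddings \<open>w \<mapsto> (w, y)\<close> and
  \<open>w \<mapsto> (x, w)\<close> bridges the two.\<close>

lemma
  fixes f :: "real ^ 'n::finite \<Rightarrow> real ^ 'm::finite \<Rightarrow> real"
  assumes "smooth_on S (\<lambda>(x, y). f x y)" "(x, y) \<in> S"
  shows has_derivative_slice1: "((\<lambda>w. f w y) has_derivative
      (\<lambda>d. frechet_derivative (\<lambda>(x, y). f x y) (at (x, y)) (d, 0))) (at x)"
    and has_derivative_slice2: "(f x has_derivative
      (\<lambda>d. frechet_derivative (\<lambda>(x, y). f x y) (at (x, y)) (0, d))) (at y)"
proof -
  note D = smooth_on_has_derivative[OF assms]
  have pair: "((\<lambda>w. (w, y)) has_derivative (\<lambda>d. (d, 0))) (at x)"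
    "((\<lambda>w. (x, w)) has_derivative (\<lambda>d. (0, d))) (at y)"
    by (auto intro!: derivative_eq_intros)
  show "((\<lambda>w. f w y) has_derivative
      (\<lambda>d. frechet_derivative (\<lambda>(x, y). f x y) (at (x, y)) (d, 0))) (at x)"
    using has_derivative_compose[OF pair(1) D] by simp
  show "(f x has_derivative
      (\<lambda>d. frechet_derivative (\<lambda>(x, y). f x y) (at (x, y)) (0, d))) (at y)"
    using has_derivative_compose[OF pair(2) D] by simp
qed

lemmas pd_slice1 = pd_eq[OF has_derivative_slice1]
lemmas pd_slice2 = pd_eq[OF has_derivative_slice2]
lemmas differentiable_slice1 = differentiableI[OF has_derivative_slice1]
lemmas differentiable_slice2 = differentiableI[OF has_derivative_slice2]

lemma
  fixes f :: "real ^ 'n::finite \<Rightarrow> real ^ 'm::finite \<Rightarrow> real"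
  assumes "open S" "smooth_on S (\<lambda>(x, y). f x y)"
  shows smooth_on_pd1: "smooth_on S (\<lambda>(x, y). pd i (\<lambda>w. f w y) x)"
    and smooth_on_pd2: "smooth_on S (\<lambda>(x, y). pd j (f x) y)"
proof -
  show "smooth_on S (\<lambda>(x, y). pd i (\<lambda>w. f w y) x)"
    by (subst smooth_on_cong[OF assms(1), where g = "\<lambda>z. frechet_derivative (\<lambda>(x, y). f x y) (at z) (axis i 1, 0)"])
       (auto simp: pd_slice1[OF assms(2)] intro!: smooth_on_frechet_derivative assms(2))
  show "smooth_on S (\<lambda>(x, y). pd j (f x) y)"
    by (subst smooth_on_cong[OF assms(1), where g = "\<lambda>z. frechet_derivative (\<lambda>(x, y). f x y) (at z) (0, axis j 1)"])
       (auto simp: pd_slice2[OF assms(2)] intro!: smooth_on_frechet_derivative assms(2))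
qed

text \<open>Partial derivatives in either slot are derivatives of the joint function along
  \<open>(axis i 1, 0)\<close> or \<open>(0, axis j 1)\<close>, so both rules are cases of
  \<open>smooth_on_symmetric\<close>.\<close>

lemma
  fixes f :: "real ^ 'n::finite \<Rightarrow> real ^ 'm::finite \<Rightarrow> real"
  assumes "open S" "smooth_on S (\<lambda>(x, y). f x y)" "(x, y) \<in> S"
  shows pd_commute12: "pd j (\<lambda>z. pd i (\<lambda>w. f w z) x) y = pd i (\<lambda>w. pd j (f w) y) x"
    and pd_commute22: "pd j (pd k (f x)) y = pd k (pd j (f x)) y"
proof -
  let ?D = "\<lambda>u z. frechet_derivative (\<lambda>(x, y). f x y) (at z) u"
  \<comment> \<open>The formulas for first partial derivatives hold on all of the open set
    \<open>S\<close>, hence may be differentiated once more.\<close>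
  have 1: "frechet_derivative (\<lambda>(x, y). pd i (\<lambda>w. f w y) x) (at (x, y)) = frechet_derivative (?D (axis i 1, 0)) (at (x, y))" for i
    using assms by (intro frechet_derivative_cong_open[of S]) (auto simp: pd_slice1)
  have 2: "frechet_derivative (\<lambda>(x, y). pd j (f x) y) (at (x, y)) = frechet_derivative (?D (0, axis j 1)) (at (x, y))" for j
    using assms by (intro frechet_derivative_cong_open[of S]) (auto simp: pd_slice2)
  show "pd j (\<lambda>z. pd i (\<lambda>w. f w z) x) y = pd i (\<lambda>w. pd j (f w) y) x"
    unfolding pd_slice2[OF smooth_on_pd1[OF assms(1,2)] assms(3)]
      pd_slice1[OF smooth_on_pd2[OF assms(1,2)] assms(3)] 1 2
    by (rule smooth_on_symmetric[OF assms])
  show "pd j (pd k (f x)) y = pd k (pd j (f x)) y"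
    unfolding pd_slice2[OF smooth_on_pd2[OF assms(1,2)] assms(3)] 2
    by (rule smooth_on_symmetric[OF assms])
qed

section \<open>Linear systems and inverse maps\<close>

lemma differentiable_det:
  fixes A :: "'a::real_normed_vector \<Rightarrow> real ^ 'n ^ 'n::finite"
  assumes "\<And>i j. (\<lambda>z. A z $ i $ j) differentiable (at y)"
  shows "(\<lambda>z. det (A z)) differentiable (at y)"
proof -
  have "(\<lambda>z. \<Prod>i\<in>I. A z $ i $ p i) differentiable (at y)" for p and I :: "'n set"
    by (induction I rule: infinite_finite_induct) (auto intro!: differentiable_mult assms)
  then show ?thesis
    unfolding det_def by (intro differentiable_sum) (auto simp: finite_permutations)
qed

text \<open>Near \<open>y\<close>, Cramer's rule writes each component of \<open>X\<close> as a
  quotient of determinants with differentiable entries. No regularity of \<open>X\<close> is assumed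
  beforehand.\<close>

lemma differentiable_linear_solution:
  fixes A :: "'a::real_normed_vector \<Rightarrow> real ^ 'n ^ 'n::finite"
  assumes A: "\<And>i j. (\<lambda>z. A z $ i $ j) differentiable (at y)"
    and b: "\<And>i. (\<lambda>z. b z $ i) differentiable (at y)"
    and V: "open V" "y \<in> V"
    and det: "\<And>z. z \<in> V \<Longrightarrow> det (A z) \<noteq> 0"
    and sol: "\<And>z. z \<in> V \<Longrightarrow> A z *v X z = b z"
  shows "(\<lambda>z. X z $ h) differentiable (at y)"
proof -
  let ?B = "\<lambda>z. \<chi> i j. if j = h then b z $ i else A z $ i $ j"
  have "(\<lambda>z. ?B z $ i $ j) differentiable (at y)" for i j
    using A b by (cases "j = h") auto
  then have "(\<lambda>z. det (?B z) / det (A z)) differentiable (at y)"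
    using A det V by (intro differentiable_divide differentiable_det) auto
  then obtain D where "((\<lambda>z. det (?B z) / det (A z)) has_derivative D) (at y)"
    by (auto simp: differentiable_def)
  moreover have "det (?B z) / det (A z) = X z $ h" if "z \<in> V" for z
    using cramer[OF det[OF that], of "X z" "b z"] sol[OF that] by (simp add: vec_eq_iff)
  ultimately have "((\<lambda>z. X z $ h) has_derivative D) (at y)"
    using V by (auto intro: has_derivative_transform_within_open)
  then show ?thesis by (rule differentiableI)
qed

text \<open>The inverse function theorem in use needs the derivative at \<open>y\<close> only,
  besides continuity and injectivity on \<open>V\<close>. The claim is then
  \<open>T' (g' (axis j 1)) = axis j 1\<close>, read off in component \<open>i\<close>.\<close>

lemma jacobian_inverse:
  fixes T :: "real ^ 'n::finite \<Rightarrow> real ^ 'n"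
  assumes V: "open V" "y \<in> V" "inj_on T V" "continuous_on V T"
    and T': "(T has_derivative T') (at y)" "\<And>v. T' v = 0 \<Longrightarrow> v = 0"
  shows "(\<Sum>m\<in>UNIV. pd m (\<lambda>z. T z $ i) y * pd j (\<lambda>\<tau>. the_inv_into V T \<tau> $ m) (T y)) = (if i = j then 1 else 0)"
proof -
  have lin: "linear T'" using T'(1) by (rule has_derivative_linear)
  then have "inj T'" using T'(2) by (simp add: linear_injective_0)
  then obtain g' where g': "linear g'" "\<And>v. T' (g' v) = v"
    using linear_injective_isomorphism[OF lin] by auto
  have "(the_inv_into V T has_derivative g') (at (T y))"
    using V(3) g'(2)
    by (intro has_derivative_inverse_strong[OF V(1,2,4) _ T'(1)]) (simp_all add: the_inv_into_f_f fun_eq_iff)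
  then have "pd j (\<lambda>\<tau>. the_inv_into V T \<tau> $ m) (T y) = g' (axis j 1) $ m" for m
    by (rule pd_eq[OF bounded_linear.has_derivative[OF bounded_linear_vec_nth]])
  moreover have "pd m (\<lambda>z. T z $ i) y = T' (axis m 1) $ i" for m
    by (rule pd_eq[OF bounded_linear.has_derivative[OF bounded_linear_vec_nth T'(1)]])
  ultimately have "(\<Sum>m\<in>UNIV. pd m (\<lambda>z. T z $ i) y * pd j (\<lambda>\<tau>. the_inv_into V T \<tau> $ m) (T y))
      = (\<Sum>m\<in>UNIV. g' (axis j 1) $ m *\<^sub>R T' (axis m 1)) $ i"
    by (simp add: mult.commute)
  also have "(\<Sum>m\<in>UNIV. g' (axis j 1) $ m *\<^sub>R T' (axis m 1)) = T' (\<Sum>m\<in>UNIV. g' (axis j 1) $ m *\<^sub>R axis m 1)"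
    by (simp add: linear_sum[OF lin] linear_cmul[OF lin])
  also have "(\<Sum>m\<in>UNIV. g' (axis j 1) $ m *\<^sub>R axis m 1) = g' (axis j 1)"
    using basis_expansion[of "g' (axis j 1)"] by (simp add: scalar_mult_eq_scaleR)
  finally show ?thesis by (simp add: g'(2) axis_def)
qed

section \<open>The transported connection\<close>

text \<open>Exchanging \<open>k\<close> and \<open>n\<close> swaps the first two derivatives of the
  metric. The third is invariant because \<open>a\<close> is symmetric on the whole open set
  \<open>U\<close>, not just at \<open>x\<close>.\<close>

lemma christoffel_sym:
  assumes "open U" "x \<in> U" "riemannian_metric U a"
  shows "christoffel a x i k n = christoffel a x i n k"
proof -
  have "pd s (\<lambda>z. a z $ k $ n) x = pd s (\<lambda>z. a z $ n $ k) x" for s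
    using assms by (intro pd_cong_open[OF assms(1,2)]) (auto simp: riemannian_metric_def)
  then show ?thesis unfolding christoffel_def by (simp add: add.commute)
qed

lemma smooth_on_transformation:
  assumes "open U" "conformally_automorphic_via U F a H t p"
  shows "smooth_on (U \<times> - {0}) (\<lambda>(x, y). t x y $ i)"
proof -
  have "open (U \<times> - {0 :: real ^ 'a})" using assms(1) by (intro open_Times) auto
  moreover have "smooth_on (U \<times> - {0}) (\<lambda>(x, y). t x y)"
    using assms(2) by (auto simp: conformally_automorphic_via_def)
  ultimately show ?thesis
    using smooth_on_vec_nth[of "U \<times> - {0}" "\<lambda>(x, y). t x y" i] by (simp add: case_prod_beta')
qed

text \<open>By the metric condition, a vector killed by the Jacobian of \<open>t x\<close> has
  length zero for the Finsler tensor, which is positive definite.\<close>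

lemma dt_nondegenerate:
  assumes F: "finsler_metric U F" and t: "conformally_automorphic_via U F a H t p"
    and x: "x \<in> U" "y \<noteq> 0"
    and v: "\<And>i. (\<Sum>m\<in>UNIV. dt t x y i m * v $ m) = 0"
  shows "v = 0"
proof (rule ccontr)
  assume "v \<noteq> 0"
  then have "(\<Sum>m\<in>UNIV. \<Sum>n\<in>UNIV. finsler_tensor F x y m n * v $ m * v $ n) > 0"
    using F x by (auto simp: finsler_metric_def)
  moreover have "(\<Sum>n\<in>UNIV. finsler_tensor F x y m n * v $ m * v $ n) = 0" for m
  proof -
    have "(\<Sum>n\<in>UNIV. finsler_tensor F x y m n * v $ m * v $ n)
        = (\<Sum>n\<in>UNIV. \<Sum>i\<in>UNIV. \<Sum>j\<in>UNIV.
            (p x y)\<^sup>2 * v $ m * a x $ i $ j * dt t x y i m * (dt t x y j n * v $ n))"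
      using t x by (auto simp: conformally_automorphic_via_def sum_distrib_left sum_distrib_right algebra_simps
          intro!: sum.cong)
    \<comment> \<open>The sum over \<open>n\<close> is moved innermost, where it is the Jacobian
      applied to \<open>v\<close>.\<close>
    also have "\<dots> = (\<Sum>i\<in>UNIV. \<Sum>j\<in>UNIV. \<Sum>n\<in>UNIV.
            (p x y)\<^sup>2 * v $ m * a x $ i $ j * dt t x y i m * (dt t x y j n * v $ n))"
      by (subst sum.swap, intro sum.cong refl sum.swap)
    also have "\<dots> = 0" by (simp add: v flip: sum_distrib_left)
    finally show ?thesis .
  qed
  ultimately show False by simp
qed

lemma dt_dy_inverse:
  assumes "open U" and F: "finsler_metric U F" and t: "conformally_automorphic_via U F a H t p"
    and x: "x \<in> U" "y \<noteq> 0"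
  shows "(\<Sum>m\<in>UNIV. dt t x y i m * dy t x y m j) = (if i = j then 1 else 0)"
proof -
  \<comment> \<open>The total derivative is given as multiplication by the matrix \<open>dt\<close>,
    so that its kernel is the one treated in \<open>dt_nondegenerate\<close>.\<close>
  define T' where "T' z v = (\<chi> i. \<Sum>m\<in>UNIV. dt t x z i m * v $ m)" for z v
  have D: "(t x has_derivative T' z) (at z)" if "z \<noteq> 0" for z
  proof -
    have "((\<lambda>z. t x z $ i) has_derivative (\<lambda>v. T' z v $ i)) (at z)" for i
    proof -
      have "\<exists>L. ((\<lambda>z. t x z $ i) has_derivative L) (at z)"
        using has_derivative_slice2[OF smooth_on_transformation[OF assms(1) t]] x that by blast
      then obtain L where L: "((\<lambda>z. t x z $ i) has_derivative L) (at z)" ..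
      have lin: "linear L" using L by (rule has_derivative_linear)
      have "L v = T' z v $ i" for v
      proof -
        have "L v = L (\<Sum>m\<in>UNIV. v $ m *\<^sub>R axis m 1)"
          using basis_expansion[of v] by (simp add: scalar_mult_eq_scaleR)
        also have "\<dots> = T' z v $ i"
          by (simp add: T'_def dt_def pd_eq[OF L] linear_sum[OF lin] linear_cmul[OF lin] mult.commute)
        finally show ?thesis .
      qed
      then have "L = (\<lambda>v. T' z v $ i)" by auto
      with L show ?thesis by simp
    qed
    then show ?thesis
      by (subst has_derivative_componentwise_within) (auto simp: Basis_vec_def inner_axis)
  qed
  have "continuous_on (- {0}) (t x)"
    using D by (auto intro!: continuous_at_imp_continuous_on has_derivative_continuous)
  moreover have "inj_on (t x) (- {0})"
    using t x by (auto simp: conformally_automorphic_via_def bij_betw_def)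
  moreover have "v = 0" if "T' y v = 0" for v
    using that by (intro dt_nondegenerate[OF F t x]) (auto simp: T'_def vec_eq_iff)
  ultimately show ?thesis
    unfolding dt_def dy_def using x by (intro jacobian_inverse[OF _ _ _ _ D]) auto
qed

text \<open>With the \<open>x\<close>-derivative moved to the left, this says
  \<open>d_n t^i = - a^i_kn t^k\<close>. It holds because the Jacobian cancels the factor
  \<open>dy\<close> in \<open>N_coeff\<close>.\<close>

lemma dt_N_coeff:
  assumes "open U" "finsler_metric U F" "conformally_automorphic_via U F a H t p" "x \<in> U" "y \<noteq> 0"
  shows "(\<Sum>h\<in>UNIV. dt t x y i h * N_coeff a t x y h n)
       = - (pd n (\<lambda>z. t z y $ i) x + (\<Sum>k\<in>UNIV. christoffel a x i k n * t x y $ k))"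
proof -
  define b where "b j = pd n (\<lambda>z. t z y $ j) x + (\<Sum>k\<in>UNIV. christoffel a x j k n * t x y $ k)" for j
  have "(\<Sum>h\<in>UNIV. dt t x y i h * N_coeff a t x y h n)
      = - (\<Sum>h\<in>UNIV. \<Sum>j\<in>UNIV. dt t x y i h * dy t x y h j * b j)"
    unfolding N_coeff_def b_def by (simp add: sum_distrib_left sum_negf mult.assoc)
  also have "\<dots> = - (\<Sum>j\<in>UNIV. (\<Sum>h\<in>UNIV. dt t x y i h * dy t x y h j) * b j)"
    by (subst sum.swap) (simp add: sum_distrib_right)
  also have "\<dots> = - b i"
    by (simp add: dt_dy_inverse[OF assms] if_distrib[of "\<lambda>u. u * _"] sum.delta cong: if_cong)
  finally show ?thesis by (simp add: b_def)
qed

text \<open>\<open>N_coeff\<close> contains \<open>dy\<close>, a derivative of the inverse map whose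
  dependence on \<open>y\<close> is not directly accessible. The linear system of
  \<open>dt_N_coeff\<close> involves only partial derivatives of \<open>t\<close>, which are
  smooth.\<close>

lemma N_coeff_differentiable:
  assumes "open U" "finsler_metric U F" "conformally_automorphic_via U F a H t p" "x \<in> U" "y \<noteq> 0"
  shows "(\<lambda>z. N_coeff a t x z h n) differentiable (at y)"
proof -
  have S: "open (U \<times> - {0 :: real ^ 'a})" using assms(1) by (intro open_Times) auto
  note sm = smooth_on_transformation[OF assms(1,3)]
  define A where "A z = (\<chi> i h. dt t x z i h)" for z
  define b where "b z = (\<chi> i. - (pd n (\<lambda>w. t w z $ i) x + (\<Sum>k\<in>UNIV. christoffel a x i k n * t x z $ k)))" for z
  have "(\<lambda>z. (\<chi> h. N_coeff a t x z h n) $ h) differentiable (at y)"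
  proof (rule differentiable_linear_solution[where A = A and b = b and V = "- {0}"])
    show "(\<lambda>z. A z $ i $ j) differentiable (at y)" for i j
      unfolding A_def dt_def using differentiable_slice2[OF smooth_on_pd2[OF S sm]] assms by simp
    show "(\<lambda>z. b z $ i) differentiable (at y)" for i
      unfolding b_def using differentiable_slice2[OF smooth_on_pd1[OF S sm]] differentiable_slice2[OF sm] assms
      by simp
    show "open (- {0 :: real ^ 'a})" "y \<in> - {0}" using assms by auto
    \<comment> \<open>The matrix of \<open>dy\<close> is a right inverse of the Jacobian.\<close>
    show "det (A z) \<noteq> 0" if "z \<in> - {0}" for z
    proof -
      have "A z ** (\<chi> m j. dy t x z m j) = mat 1"
        using that assms by (simp add: A_def matrix_matrix_mult_def mat_def dt_dy_inverse vec_eq_iff)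
      then show ?thesis using invertible_right_inverse invertible_det_nz by blast
    qed
    show "A z *v (\<chi> h. N_coeff a t x z h n) = b z" if "z \<in> - {0}" for z
      using that dt_N_coeff[OF assms(1-4)] by (simp add: A_def b_def matrix_vector_mult_def)
  qed
  then show ?thesis by simp
qed

lemma cov_deriv_dt:
  assumes "open U" "finsler_metric U F" "riemannian_metric U a" "conformally_automorphic_via U F a H t p"
    and x: "x \<in> U" "y \<noteq> 0"
  shows "cov_deriv (N_coeff a t) a (dt t) n m k x y = 0"
proof -
  have S: "open (U \<times> - {0 :: real ^ 'a})" using assms(1) by (intro open_Times) auto
  have xy: "(x, y) \<in> U \<times> - {0}" using x by simp
  note sm = smooth_on_transformation[OF assms(1,4)]
  have d: "(\<lambda>z. N_coeff a t x z h n) differentiable (at y)"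
    "(\<lambda>z. dt t x z m h) differentiable (at y)"
    "(\<lambda>z. pd n (\<lambda>w. t w z $ m) x) differentiable (at y)"
    "(\<lambda>z. t x z $ l) differentiable (at y)" for h l
    using N_coeff_differentiable[OF assms(1,2,4) x] differentiable_slice2[OF smooth_on_pd2[OF S sm] xy]
      differentiable_slice2[OF smooth_on_pd1[OF S sm] xy] differentiable_slice2[OF sm xy]
    by (auto simp: dt_def)
  \<comment> \<open>The identity holds for every nonzero \<open>z\<close>, so both sides can be
    differentiated at \<open>y\<close>.\<close>
  have "(\<Sum>h\<in>UNIV. dt t x z m h * N_coeff a t x z h n) + pd n (\<lambda>w. t w z $ m) x
      + (\<Sum>l\<in>UNIV. christoffel a x m l n * t x z $ l) = 0" if "z \<in> - {0}" for z
    using dt_N_coeff[OF assms(1,2,4) x(1), of z m n] that by simp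
  then have "pd k (\<lambda>z. (\<Sum>h\<in>UNIV. dt t x z m h * N_coeff a t x z h n) + pd n (\<lambda>w. t w z $ m) x
      + (\<Sum>l\<in>UNIV. christoffel a x m l n * t x z $ l)) y = pd k (\<lambda>z. 0) y"
    using x by (intro pd_cong_open[of "- {0}"]) auto
  also have "\<dots> = 0" by (simp add: pd_def)
  \<comment> \<open>Product rule in direction \<open>k\<close>. The Christoffel symbols depend on
    \<open>x\<close> alone, so their derivatives vanish.\<close>
  finally have "(\<Sum>h\<in>UNIV. pd k (\<lambda>z. dt t x z m h) y * N_coeff a t x y h n
        + dt t x y m h * pd k (\<lambda>z. N_coeff a t x z h n) y)
      + pd k (\<lambda>z. pd n (\<lambda>w. t w z $ m) x) y
      + (\<Sum>l\<in>UNIV. christoffel a x m l n * dt t x y l k) = 0"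
    using d by (simp add: pd_add pd_sum pd_mult dt_def) (simp add: pd_def)
  \<comment> \<open>Exchanging derivatives turns the terms with undifferentiated
    \<open>N_coeff\<close>, together with the \<open>x\<close>-derivative, into \<open>d_n\<close>
    applied to \<open>dt\<close>; the derivatives of \<open>N_coeff\<close> supply
    \<open>- D_coeff\<close>.\<close>
  moreover have "pd k (\<lambda>z. dt t x z m h) y = pd h (\<lambda>z. dt t x z m k) y" for h
    using pd_commute22[OF S sm xy] by (simp add: dt_def)
  moreover have "pd k (\<lambda>z. pd n (\<lambda>w. t w z $ m) x) y = pd n (\<lambda>w. dt t w y m k) x"
    using pd_commute12[OF S sm xy] by (simp add: dt_def)
  \<comment> \<open>The identity carries \<open>christoffel a x m l n\<close>, the covariant
    derivative \<open>christoffel a x m n l\<close>.\<close>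
  ultimately show ?thesis
    using christoffel_sym[OF assms(1) x(1) assms(3)]
    by (simp add: cov_deriv_def d_op_def D_coeff_def sum.distrib sum_negf algebra_simps)
qed

text \<open>For constant \<open>H\<close> the factor \<open>p\<close> is one fixed power of
  \<open>F\<close> times a constant, at all base points. The chain rule therefore makes
  \<open>d_n p\<close> a multiple of \<open>d_n F\<close>.\<close>

lemma
  assumes "open U" and F: "finsler_metric U F" and t: "conformally_automorphic_via U F a H t p"
    and H: "H constant_on U" and x: "x \<in> U" "y \<noteq> 0"
  shows p_differentiable1: "(\<lambda>w. p w y) differentiable (at x)"
    and p_differentiable2: "p x differentiable (at y)"
    and d_op_p: "d_op N n F x y = 0 \<Longrightarrow> d_op N n p x y = 0"
proof -
  obtain c where c: "\<And>w. w \<in> U \<Longrightarrow> H w = c" using H by (auto simp: constant_on_def)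
  have p: "p w z = (1 / c) * F w z powr (1 - c)" if "w \<in> U" "z \<noteq> 0" for w z
    using t that c by (simp add: conformally_automorphic_via_def)
  have sm: "smooth_on (U \<times> - {0}) (\<lambda>(x, y). F x y)" and pos: "F x y > 0"
    using F x by (auto simp: finsler_metric_def)
  have xy: "(x, y) \<in> U \<times> - {0}" using x by simp
  \<comment> \<open>The derivative of \<open>u \<mapsto> (1 / c) * u powr (1 - c)\<close> at
    \<open>u = F x y\<close>, which exists since \<open>F x y > 0\<close>.\<close>
  define q where "q = (1 / c) * ((1 - c) * F x y powr (1 - c - 1))"
  \<comment> \<open>Stated for a general \<open>g\<close>, as it serves both the slice in
    \<open>x\<close> and the slice in \<open>y\<close>.\<close>
  have pow: "((\<lambda>w. (1 / c) * g w powr (1 - c)) has_derivative (\<lambda>v. q * g' v)) (at w)"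
    if "(g has_derivative g') (at w)" "g w = F x y" for g g' and w :: "real ^ 'a"
  proof -
    have "((\<lambda>u. (1 / c) * u powr (1 - c)) has_real_derivative q) (at (g w))"
      unfolding q_def that(2) using pos by (intro DERIV_cmult has_real_derivative_powr)
    from DERIV_compose_FDERIV[OF this that(1)] show ?thesis by (simp add: mult.commute)
  qed
  obtain G1 where G1: "((\<lambda>w. F w y) has_derivative G1) (at x)"
    using has_derivative_slice1[OF sm xy] by blast
  obtain G2 where G2: "(F x has_derivative G2) (at y)"
    using has_derivative_slice2[OF sm xy] by blast
  have P1: "((\<lambda>w. p w y) has_derivative (\<lambda>v. q * G1 v)) (at x)"
    by (rule has_derivative_transform_within_open[OF pow[OF G1 refl] \<open>open U\<close> x(1)]) (simp add: p x)
  have P2: "(p x has_derivative (\<lambda>v. q * G2 v)) (at y)"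
    by (rule has_derivative_transform_within_open[OF pow[OF G2 refl], of "- {0}"]) (use x in \<open>auto simp: p\<close>)
  show "(\<lambda>w. p w y) differentiable (at x)" "p x differentiable (at y)"
    using P1 P2 by (auto intro: differentiableI)
  have "d_op N n p x y = q * d_op N n F x y"
    unfolding d_op_def pd_eq[OF P1] pd_eq[OF P2] pd_eq[OF G1] pd_eq[OF G2]
    by (simp add: algebra_simps sum_distrib_left)
  then show "d_op N n F x y = 0 \<Longrightarrow> d_op N n p x y = 0" by simp
qed

theorem proposition2p3:
  fixes U :: "(real ^ 'n::finite) set"
    and F :: "real ^ 'n \<Rightarrow> real ^ 'n \<Rightarrow> real"
    and a :: "real ^ 'n \<Rightarrow> real ^ 'n ^ 'n"
    and H :: "real ^ 'n \<Rightarrow> real"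
    and t :: "real ^ 'n \<Rightarrow> real ^ 'n \<Rightarrow> real ^ 'n"
    and p :: "real ^ 'n \<Rightarrow> real ^ 'n \<Rightarrow> real"
  assumes "CARD('n) \<ge> 3"
    and "open U"
    and "finsler_metric U F"
    and "riemannian_metric U a"
    and "conformally_automorphic_via U F a H t p"
    and "\<forall>x\<in>U. \<forall>y. y \<noteq> 0 \<longrightarrow> (\<forall>i. d_op (N_coeff a t) i F x y = 0)"
    and "H constant_on U"
  shows "\<forall>x\<in>U. \<forall>y. y \<noteq> 0 \<longrightarrow>
    (\<forall>n m k. cov_deriv (N_coeff a t) a (deformation_tensor p t) n m k x y = 0)"
proof (intro ballI allI impI)
  fix x y :: "real ^ 'n" and n m k
  assume x: "x \<in> U" "y \<noteq> 0"
  have S: "open (U \<times> - {0 :: real ^ 'n})" using assms(2) by (intro open_Times) auto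
  have xy: "(x, y) \<in> U \<times> - {0}" using x by simp
  note sm = smooth_on_pd2[OF S smooth_on_transformation[OF assms(2,5)]]
  note p = p_differentiable1[OF assms(2,3,5,7) x] p_differentiable2[OF assms(2,3,5,7) x]
  have d: "(\<lambda>w. dt t w y m k) differentiable (at x)" "(\<lambda>z. dt t x z m k) differentiable (at y)"
    using differentiable_slice1[OF sm xy] differentiable_slice2[OF sm xy] by (auto simp: dt_def)
  \<comment> \<open>Leibniz rule: the terms with \<open>D_coeff\<close> and
    \<open>christoffel\<close> are linear in the tensor, so the scalar \<open>p\<close> enters the
    extra term only through \<open>d_op\<close>.\<close>
  have "cov_deriv (N_coeff a t) a (deformation_tensor p t) n m k x y
      = d_op (N_coeff a t) n p x y * dt t x y m k + p x y * cov_deriv (N_coeff a t) a (dt t) n m k x y"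
    using pd_mult[OF p(1) d(1), of n] pd_mult[OF p(2) d(2)]
    by (simp add: cov_deriv_def d_op_def deformation_tensor_def sum.distrib sum_distrib_left
        sum_distrib_right algebra_simps)
  also have "\<dots> = 0"
    using d_op_p[OF assms(2,3,5,7) x] cov_deriv_dt[OF assms(2-5) x] assms(6) x by simp
  finally show "cov_deriv (N_coeff a t) a (deformation_tensor p t) n m k x y = 0" .
qed

end
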